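(* Let $k \ge 0$ be an integer, let $G$ be a graph on $n$ vertices and let $d_1 \le \ldots \le d_n$ be its degree sequence. Let $A = \{0 \le d_1 \le \ldots \le d_n \le n-1\}$ and let $V_1, V_2, \ldots, V_s$ be the sets of vertices corresponding to the degree subsequences $A_1, A_2, \ldots, A_s$ given by Algorithm 1 under input $A$. Then $V_1 \cup V_2 \cup \ldots \cup V_s$ is a partition of $V(G)$ into $s = \varphi_k(G)$ $k$-small sets.
   Context: Graphs are finite and simple with nonempty vertex set; $n = |V(G)|$. A set $W \subseteq V(G)$ is $k$-small if $\deg(v) \le n - |W| + k$ for every $v \in W$. $\varphi_k(G)$ is the minimum integer $t$ such that $V(G)$ can be partitioned into $t$ $k$-small sets. The vertices of $G$ are ordered $v_1, \ldots, v_n$ so that $\deg(v_j) = d_j$; the vertex set corresponding to a subsequence consisting of the entries $d_j$, $j \in J$, is $\{v_j : j \in J\}$ (entries of a sequence are distinguished by their indices). Algorithm 1 (input: a sequence $A = \{0 \le a_1 \le \ldots \le a_m \le n-1\}$ of $m$ integers; here $m=n$ and $a_j=d_j$): Set $i := 0$ and $R_0 := A$. Repeat the following until $R_i = \emptyset$: (1) $n_i := |R_i|$; (2) $p_i := \min\{n_i,\, n - a_{n_i} + k\}$; (3) $A_{i+1} := \{a_{n_i - p_i + 1}, a_{n_i - p_i + 2}, \ldots, a_{n_i}\}$; (4) $R_{i+1} := R_i \setminus A_{i+1}$; (5) $i := i+1$. Output: $s := i$ and $A_1, A_2, \ldots, A_s$. (Thus each $R_i$ is the initial segment $a_1, \ldots,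 a_{n_i}$ of the sequence.) *)

theory Defs
  imports "HOL-Library.Disjoint_Sets" "HOL-Library.While_Combinator"
begin

definition simple_graph :: "'a set \<Rightarrow> 'a set set \<Rightarrow> bool" where
  "simple_graph V E \<longleftrightarrow>
     finite V \<and> V \<noteq> {} \<and> (\<forall>e\<in>E. e \<subseteq> V \<and> card e = 2)"

definition degree :: "'a set set \<Rightarrow> 'a \<Rightarrow> nat" where
  "degree E v = card {e \<in> E. v \<in> e}"

(* For finite V the inclusion W \<subseteq> V gives card W \<le> card V, so the subtraction
   on nat does not truncate. *)
definition k_small :: "'a set \<Rightarrow> 'a set set \<Rightarrow> nat \<Rightarrow> 'a set \<Rightarrow> bool" where
  "k_small V E k W \<longleftrightarrow>
     W \<subseteq> V \<and> (\<forall>v\<in>W. degree E v \<le> card V - card W + k)"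

(* In a simple graph singletons are k-small, so the minimum is over a nonempty set. *)
definition phi :: "'a set \<Rightarrow> 'a set set \<Rightarrow> nat \<Rightarrow> nat" where
  "phi V E k =
     (LEAST t. \<exists>P. partition_on V P \<and> card P = t \<and> (\<forall>W\<in>P. k_small V E k W))"

(* A sequence a_1, ..., a_m is a function a restricted to {1..m}, and a subsequence is the
   set of its indices, so that equal entries at different positions stay distinct.
   The loop state is (R_i, [A_1, ..., A_i]); the counter i is the length of the list.
   The result is None if the loop does not terminate.
   On admissible inputs (a_j \<le> n - 1) the subtraction n - a_j does not truncate. *)
definition algorithm1 :: "nat \<Rightarrow> nat \<Rightarrow> nat \<Rightarrow> (nat \<Rightarrow> nat) \<Rightarrow> nat set list option" where
  "algorithm1 n k m a =
     map_option snd
       (while_option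
         (\<lambda>(R, As). R \<noteq> {})
         (\<lambda>(R, As).
            let r = card R;
                p = min r (n - a r + k);
                A = {r - p + 1..r}
            in (R - A, As @ [A]))
         ({1..m}, []))"

end

theory Submission
  imports Defs
begin

(* Algorithm 1 removes from the initial segment {1..r} the largest block ending at r that the
   degree bound of v_r allows. For optimality one compares cardinalities only: if a set U of at
   least r vertices is covered by t k-small sets, then some vertex of U has degree at least d_r,
   so the k-small set W containing it has at most n - d_r + k elements. Hence U - W still has at
   least as many vertices as the algorithm has indices left, and it is covered by t - 1 k-small
   sets. By induction the algorithm stops after at most t rounds. *)

text \<open>Terminating runs of the loop, in a form that allows rule induction: \<open>r\<close> is
  the right end of the remaining initial segment and \<open>p r\<close> the size of the next block.
  The bounds on \<open>p r\<close> make each round shrink the segment and keep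
  \<open>r - p r\<close> from truncating.\<close>

inductive greedy_blocks :: "(nat \<Rightarrow> nat) \<Rightarrow> nat \<Rightarrow> nat set list \<Rightarrow> bool"
  for p :: "nat \<Rightarrow> nat" where
  empty: "greedy_blocks p 0 []"
| block: "\<lbrakk>0 < p r; p r \<le> r; greedy_blocks p (r - p r) Bs\<rbrakk>
    \<Longrightarrow> greedy_blocks p r ({r - p r + 1..r} # Bs)"

lemma greedy_blocks_exists:
  assumes "\<And>r. \<lbrakk>0 < r; r \<le> m\<rbrakk> \<Longrightarrow> 0 < p r \<and> p r \<le> r"
  shows "\<exists>Bs. greedy_blocks p m Bs"
  using assms
proof (induction m rule: less_induct)
  case (less m)
  show ?case
  proof (cases "m = 0")
    case True
    then show ?thesis by (auto intro: greedy_blocks.empty)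
  next
    case False
    then have p: "0 < p m" "p m \<le> m" using less.prems by auto
    then have "\<exists>Bs. greedy_blocks p (m - p m) Bs"
      using less.prems by (intro less.IH) auto
    then show ?thesis using p greedy_blocks.block by blast
  qed
qed

text \<open>The accumulator \<open>As\<close> is arbitrary because the loop appends new blocks at
  the end, whereas \<open>greedy_blocks\<close> puts them in front.\<close>

lemma greedy_blocks_while_option:
  assumes "greedy_blocks (\<lambda>r. min r (n - a r + k)) m Bs"
  shows "while_option (\<lambda>(R, As). R \<noteq> {})
     (\<lambda>(R, As). let r = card R; p = min r (n - a r + k); A = {r - p + 1..r}
        in (R - A, As @ [A])) ({1..m}, As) = Some ({}, As @ Bs)"
  using assms
proof (induction arbitrary: As rule: greedy_blocks.induct)
  case empty
  then show ?case by (simp add: while_option_unfold)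
next
  case (block r Bs)
  \<comment> \<open>What remains is again an initial segment, so its cardinality is its last index
    in the next round too.\<close>
  have "{1..r} - {r - min r (n - a r + k) + 1..r} = {1..r - min r (n - a r + k)}"
    by auto
  moreover have "{1..r} \<noteq> {}" using block.hyps by auto
  ultimately show ?case
    using block.IH[of "As @ [{r - min r (n - a r + k) + 1..r}]"]
    by (subst while_option_unfold) (simp add: Let_def)
qed

lemma greedy_blocks_algorithm1:
  assumes "greedy_blocks (\<lambda>r. min r (n - a r + k)) m Bs"
  shows "algorithm1 n k m a = Some Bs"
  unfolding algorithm1_def greedy_blocks_while_option[OF assms] by simp

lemma greedy_blocks_partition:
  assumes "greedy_blocks p m Bs"
  shows "partition_on {1..m} (set Bs) \<and> distinct Bs"
  using assms
proof (induction rule: greedy_blocks.induct)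
  case empty
  then show ?case by (simp add: partition_on_def)
next
  case (block r Bs)
  let ?A = "{r - p r + 1..r}"
  have Un: "\<Union>(set Bs) = {1..r - p r}" using block.IH by (simp add: partition_on_def)
  have "{1..r} - ?A = {1..r - p r}" by auto
  moreover have "disjnt ?A (\<Union>(set Bs))" unfolding Un by (auto simp: disjnt_def)
  ultimately have "partition_on {1..r} (insert ?A (set Bs))"
    using block.IH block.hyps by (subst partition_on_insert) auto
  moreover have "?A \<notin> set Bs"
  proof
    assume "?A \<in> set Bs"
    then have "?A \<subseteq> {1..r - p r}" using Un by blast
    then show False using block.hyps by auto
  qed
  ultimately show ?case using block.IH by simp
qed

text \<open>The witness is the right end of the block, whose entry fixes the block's size. In a
  sorted sequence this entry is the largest of the block, which is what k-smallness needs.\<close>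

lemma greedy_blocks_card:
  assumes "greedy_blocks p m Bs" "J \<in> set Bs" "j \<in> J"
  shows "\<exists>r\<in>{1..m}. card J = p r \<and> j \<le> r"
  using assms
proof (induction rule: greedy_blocks.induct)
  case (block r Bs)
  show ?case
  proof (cases "J \<in> set Bs")
    case True
    then show ?thesis using block by force
  next
    case False
    then have "J = {r - p r + 1..r}" using block by simp
    then show ?thesis using block.hyps block.prems by (intro bexI[of _ r]) auto
  qed
qed simp

text \<open>An edge at \<open>x\<close> is determined by its other end. The strict bound makes
  \<open>n - d r\<close> positive, so that blocks are nonempty even for
  \<open>k = 0\<close>.\<close>

lemma degree_less_card:
  assumes "simple_graph V E" "x \<in> V"
  shows "degree E x < card V"
proof -
  have fin: "finite V" and E: "\<And>e. e \<in> E \<Longrightarrow> e \<subseteq> V \<and> card e = 2"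
    using assms by (auto simp: simple_graph_def)
  have "{e \<in> E. x \<in> e} \<subseteq> (\<lambda>y. {x, y}) ` (V - {x})"
  proof
    fix e assume e: "e \<in> {e \<in> E. x \<in> e}"
    then obtain y z where "e = {y, z}" "y \<noteq> z"
      using E by (metis (no_types, lifting) card_2_iff mem_Collect_eq)
    with e E[of e] show "e \<in> (\<lambda>y. {x, y}) ` (V - {x})" by auto
  qed
  then have "degree E x \<le> card ((\<lambda>y. {x, y}) ` (V - {x}))"
    unfolding degree_def using fin by (intro card_mono) auto
  also have "\<dots> \<le> card (V - {x})" using fin by (intro card_image_le) auto
  also have "\<dots> < card V" using fin assms(2) by (rule card_Diff1_less)
  finally show ?thesis .
qed

lemma card_k_small_le:
  assumes "finite V" "k_small V E k W" "x \<in> W"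
  shows "card W \<le> card V - degree E x + k"
proof -
  have "card W \<le> card V" using assms by (auto simp: k_small_def intro: card_mono)
  moreover have "degree E x \<le> card V - card W + k" using assms by (auto simp: k_small_def)
  ultimately show ?thesis by linarith
qed

text \<open>\<open>P\<close> is only required to cover \<open>U\<close>, not to partition it: this
  is preserved when \<open>W\<close> is removed from both, although other members of
  \<open>P\<close> may still meet \<open>W\<close>.\<close>

lemma greedy_blocks_length_le:
  assumes fin: "finite V"
    and v: "bij_betw v {1..card V} V"
    and d: "\<And>j. j \<in> {1..card V} \<Longrightarrow> degree E (v j) = d j"
    and mono: "mono_on {1..card V} d"
    and blocks: "greedy_blocks (\<lambda>r. min r (card V - d r + k)) m Bs"
    and "m \<le> card U" "U \<subseteq> V" "U \<subseteq> \<Union>P" "finite P" "\<forall>W\<in>P. k_small V E k W"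
  shows "length Bs \<le> card P"
  using assms(5-)
proof (induction arbitrary: U P rule: greedy_blocks.induct)
  case empty
  then show ?case by simp
next
  case (block r Bs)
  have fin_U: "finite U" using fin block.prems finite_subset by blast
  \<comment> \<open>Fewer than \<open>r\<close> vertices have an index below \<open>r\<close>, so
    they cannot exhaust \<open>U\<close>; some vertex of \<open>U\<close> has index at least
    \<open>r\<close>.\<close>
  have "card (v ` {1..<r}) \<le> r - 1"
    using card_image_le[of "{1..<r}" v] by simp
  then have "card (v ` {1..<r}) < card U" using block.hyps block.prems by linarith
  then obtain x where x: "x \<in> U" "x \<notin> v ` {1..<r}"
    by (metis card_mono finite_atLeastLessThan finite_imageI leD subsetI)
  then obtain i where i: "i \<in> {1..card V}" "x = v i"
    using v block.prems by (metis bij_betw_imp_surj_on imageE subsetD)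
  have ri: "r \<le> i" using x(2) i by (cases "r \<le> i") auto
  then have "r \<in> {1..card V}" using i block.hyps by auto
  then have deg: "d r \<le> degree E x" using mono i ri d[OF i(1)] by (auto simp: mono_on_def)
  obtain W where W: "W \<in> P" "x \<in> W" using x block.prems by auto
  have "card W \<le> card V - degree E x + k"
    using fin W block.prems by (intro card_k_small_le) auto
  then have cW: "card W \<le> card V - d r + k" using deg by linarith
  have "finite W"
    using fin W block.prems by (meson k_small_def finite_subset)
  then have "card U - card W \<le> card (U - W)" by (rule diff_card_le_card_Diff)
  \<comment> \<open>If the minimum is \<open>r\<close>, the left side is 0; otherwise
    \<open>W\<close> is no larger than the block, while \<open>U\<close> has at least
    \<open>r\<close> elements.\<close>
  then have "r - min r (card V - d r + k) \<le> card (U - W)"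
    using cW block.prems(1) by linarith
  then have "length Bs \<le> card (P - {W})"
    using block.prems by (intro block.IH[of "U - W"]) auto
  also have "\<dots> < card P" using block.prems W by (intro card_Diff1_less)
  finally show ?case by simp
qed

theorem corollary3p3:
  fixes V :: "'a set" and E :: "'a set set" and k n :: nat
    and v :: "nat \<Rightarrow> 'a" and d :: "nat \<Rightarrow> nat"
  assumes "simple_graph V E"
    and "n = card V"
    and "bij_betw v {1..n} V"
    and "\<And>j. j \<in> {1..n} \<Longrightarrow> degree E (v j) = d j"
    and "mono_on {1..n} d"
  shows "\<exists>As Vs. algorithm1 n k n d = Some As \<and> Vs = map (\<lambda>J. v ` J) As \<and>
           partition_on V (set Vs) \<and> distinct Vs \<and>
           (\<forall>W\<in>set Vs. k_small V E k W) \<and>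
           length Vs = phi V E k"
proof -
  let ?p = "\<lambda>r. min r (n - d r + k)"
  have fin: "finite V" using assms(1) by (simp add: simple_graph_def)
  have inj: "inj_on v {1..n}" and im: "v ` {1..n} = V"
    using assms(3) by (auto simp: bij_betw_def)
  have dn: "d j < n" if "j \<in> {1..n}" for j
    using degree_less_card[OF assms(1), of "v j"] imageI[OF that, of v] im assms(2) assms(4)[OF that]
    by simp
  then have "0 < ?p r \<and> ?p r \<le> r" if "0 < r" "r \<le> n" for r
    using that by (simp add: Suc_le_eq)
  then obtain As where As: "greedy_blocks ?p n As"
    using greedy_blocks_exists[of n ?p] by blast
  have part: "partition_on {1..n} (set As)" and dist: "distinct As"
    using greedy_blocks_partition[OF As] by auto
  then have sub: "J \<subseteq> {1..n}" if "J \<in> set As" for J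
    using that by (auto simp: partition_on_def)
  define Vs where "Vs = map (\<lambda>J. v ` J) As"
  have inj': "inj_on (\<lambda>J. v ` J) (set As)"
    using sub inj by (meson inj_onI inj_on_image_eq_iff)
  have dist': "distinct Vs" using dist inj' by (simp add: Vs_def distinct_map)
  \<comment> \<open>\<open>partition_on_inj_image\<close> discards the empty set from the image;
    nothing is lost, since no block is empty.\<close>
  have part': "partition_on V (set Vs)"
    using partition_on_inj_image[OF part inj] im part
    by (auto simp: Vs_def partition_on_def image_iff)
  have small: "k_small V E k (v ` J)" if J: "J \<in> set As" for J
    unfolding k_small_def
  proof (intro conjI ballI)
    show "v ` J \<subseteq> V" using sub[OF J] im by auto
    fix x assume "x \<in> v ` J"
    then obtain j where j: "j \<in> J" "x = v j" by auto
    then obtain r where r: "r \<in> {1..n}" "card J = ?p r" "j \<le> r"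
      using greedy_blocks_card[OF As J] by blast
    have jn: "j \<in> {1..n}" using sub[OF J] j by auto
    have "card (v ` J) = card J"
      using sub[OF J] inj by (meson card_image inj_on_subset)
    moreover have "d j \<le> d r" using assms(5) jn r by (auto simp: mono_on_def)
    moreover have "degree E x = d j" using assms(4) jn j by simp
    \<comment> \<open>From \<open>card J \<le> n - d r + k\<close> and \<open>d r < n\<close> one
      gets \<open>d r \<le> n - card J + k\<close>, and \<open>d r\<close> bounds every degree in
      the block.\<close>
    ultimately show "degree E x \<le> card V - card (v ` J) + k"
      using r(1,2) dn[OF r(1)] assms(2) by auto
  qed
  have "phi V E k = length Vs"
    unfolding phi_def
  proof (rule Least_equality)
    show "\<exists>P. partition_on V P \<and> card P = length Vs \<and> (\<forall>W\<in>P. k_small V E k W)"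
      using part' distinct_card[OF dist'] small
      by (intro exI[of _ "set Vs"]) (simp add: Vs_def)
  next
    fix t assume "\<exists>P. partition_on V P \<and> card P = t \<and> (\<forall>W\<in>P. k_small V E k W)"
    then obtain P where P: "partition_on V P" "card P = t" "\<forall>W\<in>P. k_small V E k W" by auto
    \<comment> \<open>The covering bound is applied to the whole vertex set, \<open>U = V\<close>
      and \<open>m = n\<close>.\<close>
    have "length As \<le> card P"
      using greedy_blocks_length_le[OF fin, of v E d k n As V P] assms As P
        finite_elements[OF fin P(1)]
      by (auto simp: partition_on_def)
    then show "length Vs \<le> t" using P by (simp add: Vs_def)
  qed
  then show ?thesis
    using greedy_blocks_algorithm1[OF As] part' dist' small by (auto simp: Vs_def)
qed

end
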